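(* Let $n$ be an integer with $n>4$ such that $n$ is divisible by neither $2$ nor $3$, and let $\zeta=e^{2i\pi/n}$. Then $$\prod_{k=1}^{n-1}\left(1-\zeta^k+\zeta^{2k}\right)=1.$$ Consequently, $1-\zeta+\zeta^2$ is a unit in the ring of integers of $\mathbb{Q}(\zeta)$. *)

theory Defs
  imports
    "HOL-Analysis.Analysis"
    "HOL-Algebra.Generated_Fields"
    "HOL-Computational_Algebra.Polynomial"
    "HOL-Decision_Procs.Algebra_Aux"
begin

definition rat_adjoin :: "complex \<Rightarrow> complex set" where
  "rat_adjoin z = generate_field cring_class_ops (insert z \<rat>)"

definition ring_of_integers :: "complex set \<Rightarrow> complex ring" where
  "ring_of_integers K = cring_class_ops\<lparr>carrier := {x \<in> K. algebraic_int x}\<rparr>"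

end

theory Submission
  imports
    Defs
    "HOL-Number_Theory.Cong"
    "Jordan_Normal_Form.Char_Poly"
begin

text \<open>
  Since \<open>(1 + x) * (1 - x + x^2) = 1 + x^3\<close>, the product over \<open>k\<close> is the quotient of
  \<open>\<Prod>(1 + \<zeta>^(3k))\<close> by \<open>\<Prod>(1 + \<zeta>^k)\<close>. The two products have the same factors, because
  \<open>k \<mapsto> 3k\<close> permutes the nonzero residues modulo \<open>n\<close>, and no factor vanishes, because \<open>-1\<close> is
  not an \<open>n\<close>-th root of unity for odd \<open>n\<close>. The factors with \<open>k > 1\<close> then multiply to an
  inverse of \<open>1 - \<zeta> + \<zeta>^2\<close> in \<open>\<int>[\<zeta>]\<close>. Every \<open>p(\<zeta>) \<in> \<int>[\<zeta>]\<close> is an algebraic integer,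
  because it is an eigenvalue of the integer circulant matrix with symbol \<open>p\<close>, the
  eigenvector being \<open>(1, \<zeta>, \<dots>, \<zeta>^(n-1))\<close>.
\<close>

lemma bij_betw_mult_mod:
  fixes a n :: nat
  assumes "Rings.coprime a n" and "n > 0"
  shows "bij_betw (\<lambda>k. a * k mod n) {1..n - 1} {1..n - 1}"
proof -
  have inj: "inj_on (\<lambda>k. a * k mod n) {1..n - 1}"
  proof (rule inj_onI)
    fix x y assume xy: "x \<in> {1..n - 1}" "y \<in> {1..n - 1}" "a * x mod n = a * y mod n"
    then have "[a * x = a * y] (mod n)"
      by (simp add: cong_def)
    then have "[x = y] (mod n)"
      using assms(1) by (simp add: cong_mult_lcancel_nat)
    then show "x = y"
      using xy assms(2) by (auto simp: cong_def)
  qed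
  have "a * k mod n \<in> {1..n - 1}" if k: "k \<in> {1..n - 1}" for k
  proof -
    have "\<not> n dvd k"
      using k by (auto dest: dvd_imp_le)
    then have "\<not> n dvd a * k"
      using assms(1) by (simp add: coprime_commute coprime_dvd_mult_right_iff)
    then show ?thesis
      using assms(2) mod_less_divisor[of n "a * k"]
      by (simp add: dvd_eq_mod_eq_0 del: mod_less_divisor)
  qed
  \<comment> \<open>An injective self-map of a finite set is onto.\<close>
  then show ?thesis
    using inj by (intro bij_betw_imageI endo_inj_surj) auto
qed

lemma power_mod_root_of_unity:
  fixes z :: "'a :: monoid_mult"
  assumes "z ^ n = 1"
  shows "z ^ (m mod n) = z ^ m"
proof -
  have "z ^ m = z ^ (n * (m div n) + m mod n)"
    by simp
  also have "\<dots> = z ^ (m mod n)"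
    by (simp only: power_add power_mult assms power_one mult_1)
  finally show ?thesis
    by simp
qed

text \<open>Exponents of \<open>z\<close> matter only modulo \<open>n\<close>, so multiplying them
  by a unit \<open>a\<close> permutes the factors. It serves below with
  \<open>a = 3\<close>.\<close>

lemma prod_powers_root_of_unity_mult:
  fixes z :: "'a :: monoid_mult" and f :: "'a \<Rightarrow> 'b :: comm_monoid_mult"
  assumes "z ^ n = 1" and "Rings.coprime a n" and "n > 0"
  shows "(\<Prod>k = 1..n - 1. f (z ^ (a * k))) = (\<Prod>k = 1..n - 1. f (z ^ k))"
proof -
  have "(\<Prod>k = 1..n - 1. f (z ^ (a * k))) = (\<Prod>k = 1..n - 1. f (z ^ (a * k mod n)))"
    by (simp only: power_mod_root_of_unity[OF assms(1)])
  also have "\<dots> = (\<Prod>k = 1..n - 1. f (z ^ k))"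
    using bij_betw_mult_mod[OF assms(2,3)] by (rule prod.reindex_bij_betw)
  finally show ?thesis .
qed

lemma prod_one_minus_plus_root_of_unity:
  fixes z :: "'a :: field_char_0"
  assumes "z ^ n = 1" and "odd n" and "\<not> 3 dvd n"
  shows "(\<Prod>k = 1..n - 1. 1 - z ^ k + z ^ (2 * k)) = 1"
proof -
  have "Rings.coprime 3 n"
    using assms(3) by (simp add: prime_imp_coprime)
  moreover have "n > 0"
    using assms(2) by (rule odd_pos)
  ultimately have perm: "(\<Prod>k = 1..n - 1. 1 + z ^ (3 * k)) = (\<Prod>k = 1..n - 1. 1 + z ^ k)"
    using prod_powers_root_of_unity_mult[OF assms(1), of 3 "\<lambda>x. 1 + x"] by simp
  have "1 + z ^ k \<noteq> 0" for k
  proof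
    assume "1 + z ^ k = 0"
    then have "z ^ k = - 1"
      by (simp add: eq_neg_iff_add_eq_0 add.commute)
    \<comment> \<open>Raising \<open>z ^ k = - 1\<close> to the power \<open>n\<close> gives 1 on
      the left and, \<open>n\<close> being odd, -1 on the right.\<close>
    then have "(z ^ n) ^ k = (- 1) ^ n"
      by (metis power_mult mult.commute)
    then show False
      using assms(1,2) by simp
  qed
  then have nz: "(\<Prod>k = 1..n - 1. 1 + z ^ k) \<noteq> 0"
    by simp
  have "(1 + z ^ k) * (1 - z ^ k + z ^ (2 * k)) = 1 + z ^ (3 * k)" for k
  proof -
    have "z ^ (2 * k) = (z ^ k) ^ 2" "z ^ (3 * k) = (z ^ k) ^ 3"
      by (simp_all add: power_mult [symmetric] mult.commute)
    then show ?thesis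
      by (simp add: algebra_simps power2_eq_square power3_eq_cube)
  qed
  then have "(\<Prod>k = 1..n - 1. 1 + z ^ k) * (\<Prod>k = 1..n - 1. 1 - z ^ k + z ^ (2 * k))
      = (\<Prod>k = 1..n - 1. 1 + z ^ k)"
    using perm by (simp add: prod.distrib [symmetric])
  then show ?thesis
    using nz by simp
qed

lemma rat_adjoin_gen: "z \<in> rat_adjoin z"
  unfolding rat_adjoin_def by (rule generate_field.incl) simp

lemma Rats_subset_rat_adjoin: "\<rat> \<subseteq> rat_adjoin z"
  unfolding rat_adjoin_def by (auto intro: generate_field.incl)

lemma rat_adjoin_add: "x \<in> rat_adjoin z \<Longrightarrow> y \<in> rat_adjoin z \<Longrightarrow> x + y \<in> rat_adjoin z"
  unfolding rat_adjoin_def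
  using generate_field.eng_add[of x cring_class_ops] by (simp add: plus_class)

lemma rat_adjoin_mult: "x \<in> rat_adjoin z \<Longrightarrow> y \<in> rat_adjoin z \<Longrightarrow> x * y \<in> rat_adjoin z"
  unfolding rat_adjoin_def
  using generate_field.eng_mult[of x cring_class_ops] by (simp add: times_class)

text \<open>Horner's scheme: each step is one multiplication by \<open>z\<close> and one addition of
  an integer.\<close>

lemma poly_of_int_in_rat_adjoin: "poly (map_poly of_int p) z \<in> rat_adjoin z"
proof (induction p)
  case 0
  show ?case
    using Rats_subset_rat_adjoin[of z] by auto
next
  case (pCons a p)
  have "of_int a \<in> rat_adjoin z"
    using Rats_subset_rat_adjoin[of z] by auto
  then show ?case
    using pCons.IH by (simp add: of_int_hom.map_poly_pCons_hom rat_adjoin_add rat_adjoin_mult rat_adjoin_gen)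
qed

text \<open>The characteristic polynomial of an integer matrix is monic with integer coefficients,
  and \<open>x\<close> is a root of it.\<close>

lemma algebraic_int_eigenvalue:
  fixes A :: "int mat" and x :: "'a :: field_char_0"
  assumes "A \<in> carrier_mat n n" and "eigenvalue (map_mat of_int A) x"
  shows "algebraic_int x"
proof -
  have "poly (char_poly (map_mat of_int A)) x = 0"
    using assms by (subst eigenvalue_root_char_poly[symmetric, of _ n]) auto
  then have "poly (map_poly of_int (char_poly A)) x = 0"
    by (simp add: of_int_hom.char_poly_hom[OF assms(1)])
  moreover have "lead_coeff (char_poly A) = 1"
    using degree_monic_char_poly[OF assms(1)] by simp
  ultimately show ?thesis
    unfolding algebraic_int_altdef_ipoly by blast
qed

lemma algebraic_int_poly_root_of_unity:
  fixes z :: "'a :: field_char_0" and p :: "int poly"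
  assumes "z ^ n = 1" and "n > 0"
  shows "algebraic_int (poly (map_poly of_int p) z)"
proof (rule algebraic_int_eigenvalue)
  \<comment> \<open>Row \<open>i\<close> lists the coefficients of \<open>X^i * p(X)\<close> reduced
    modulo \<open>X^n - 1\<close>. Entries are sums over \<open>c\<close> because several exponents
    share a residue once \<open>degree p\<close> reaches \<open>n\<close>.\<close>
  define A where "A = mat n n (\<lambda>(i, j). \<Sum>c\<le>degree p. if (i + c) mod n = j then Polynomial.coeff p c else 0)"
  define v where "v = Matrix.vec n (\<lambda>j. z ^ j)"
  show A: "A \<in> carrier_mat n n"
    by (simp add: A_def)
  have "map_mat of_int A *\<^sub>v v = poly (map_poly of_int p) z \<cdot>\<^sub>v v"
  proof (rule eq_vecI)
    fix i assume "i < dim_vec (poly (map_poly of_int p) z \<cdot>\<^sub>v v)"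
    then have i: "i < n"
      by (simp add: v_def)
    then have "vec_index (map_mat of_int A *\<^sub>v v) i
        = (\<Sum>j<n. (\<Sum>c\<le>degree p. if (i + c) mod n = j then of_int (Polynomial.coeff p c) else 0) * z ^ j)"
      by (simp add: A_def v_def scalar_prod_def lessThan_atLeast0 of_int_sum if_distrib[of of_int] cong: if_cong)
    also have "\<dots> = (\<Sum>c\<le>degree p. \<Sum>j<n. if (i + c) mod n = j then of_int (Polynomial.coeff p c) * z ^ j else 0)"
      by (subst sum.swap) (auto simp: sum_distrib_right intro!: sum.cong)
    \<comment> \<open>For each \<open>c\<close> only \<open>j = (i + c) mod n\<close> contributes,
      and it lies below \<open>n\<close> since \<open>n > 0\<close>.\<close>
    also have "\<dots> = (\<Sum>c\<le>degree p. of_int (Polynomial.coeff p c) * z ^ ((i + c) mod n))"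
      using assms(2) by simp
    also have "\<dots> = poly (map_poly of_int p) z * z ^ i"
      by (simp add: power_mod_root_of_unity[OF assms(1)] poly_altdef power_add sum_distrib_left mult_ac)
    finally show "vec_index (map_mat of_int A *\<^sub>v v) i = vec_index (poly (map_poly of_int p) z \<cdot>\<^sub>v v) i"
      using i by (simp add: v_def)
  qed (simp add: A_def v_def)
  moreover have "v \<noteq> 0\<^sub>v n"
  proof
    assume "v = 0\<^sub>v n"
    then have "vec_index v 0 = vec_index (0\<^sub>v n) 0"
      by simp
    then show False
      using assms(2) by (simp add: v_def)
  qed
  ultimately show "eigenvalue (map_mat of_int A) (poly (map_poly of_int p) z)"
    using A unfolding eigenvalue_def eigenvector_def by (intro exI[of _ v]) (simp add: v_def)
qed

theorem theorem1:
  fixes n :: nat and \<zeta> :: complex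
  assumes "n > 4" and "\<not> 2 dvd n" and "\<not> 3 dvd n"
    and "\<zeta> = exp (2 * \<i> * complex_of_real pi / of_nat n)"
  shows "(\<Prod>k = 1..n - 1. 1 - \<zeta> ^ k + \<zeta> ^ (2 * k)) = 1 \<and>
    1 - \<zeta> + \<zeta>\<^sup>2 \<in> Units (ring_of_integers (rat_adjoin \<zeta>))"
proof -
  define R where "R = ring_of_integers (rat_adjoin \<zeta>)"
  have root: "\<zeta> ^ n = 1"
    using assms(1) complex_root_unity[of n 1] by (simp add: assms(4) mult_ac)
  then have prod: "(\<Prod>k = 1..n - 1. 1 - \<zeta> ^ k + \<zeta> ^ (2 * k)) = 1"
    using assms(2,3) by (rule prod_one_minus_plus_root_of_unity)
  have carrier: "poly (map_poly of_int p) \<zeta> \<in> carrier R" for p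
    using assms(1) algebraic_int_poly_root_of_unity[OF root]
    by (simp add: R_def ring_of_integers_def poly_of_int_in_rat_adjoin)
  \<comment> \<open>Writing the factors as integer polynomials makes their product a single
    polynomial in \<open>\<zeta>\<close>, so \<open>carrier\<close> applies to \<open>y\<close>
    directly.\<close>
  define p :: "nat \<Rightarrow> int poly"
    where "p k = 1 - Polynomial.monom 1 k + Polynomial.monom 1 (2 * k)" for k
  have p: "poly (map_poly of_int (p k)) \<zeta> = 1 - \<zeta> ^ k + \<zeta> ^ (2 * k)" for k
    by (simp add: p_def hom_distribs poly_monom)
  define y where "y = poly (map_poly of_int (\<Prod>k = 2..n - 1. p k)) \<zeta>"
  have "y = (\<Prod>k = 2..n - 1. 1 - \<zeta> ^ k + \<zeta> ^ (2 * k))"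
    by (simp add: y_def of_int_poly_hom.hom_prod poly_prod p)
  \<comment> \<open>The factor at \<open>k = 1\<close> is split off; the index range is nonempty
    because \<open>n > 4\<close>.\<close>
  then have inverse: "(1 - \<zeta> + \<zeta>\<^sup>2) * y = 1"
    using prod assms(1) by (simp add: prod.atLeast_Suc_atMost numeral_2_eq_2)
  have "1 - \<zeta> + \<zeta>\<^sup>2 \<in> carrier R"
    using carrier[of "p 1"] p[of 1] by simp
  moreover have "y \<in> carrier R"
    unfolding y_def by (rule carrier)
  ultimately have "1 - \<zeta> + \<zeta>\<^sup>2 \<in> Units R"
    using inverse
    by (auto simp: Units_def R_def ring_of_integers_def cring_class_ops_def mult.commute intro!: bexI[of _ y])
  then show ?thesis
    using prod by (simp add: R_def)
qed

end
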